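(* Let $\alpha$ and $\beta$ be a pair of Mannheim curves in $S^3$, and let $\kappa_\alpha$ and $\tau_\alpha$ be the curvature and torsion of $\alpha$. Then there exist a constant $\lambda$ and a non-constant function $\mu$ (defined along $\alpha$) such that $$1=\lambda\kappa_\alpha+\mu\tau_\alpha .$$
   Context: $S^3=\{x\in\mathbb{R}^4:\langle x,x\rangle=1\}$ is the unit sphere with Levi-Civita connection $\overline{\nabla}$. All curves are smooth, immersed, defined on open intervals and parametrized by arc length. A curve in $S^3$ with nowhere zero curvature $\kappa$ has a Frenet frame $\{T,N,B\}$ (orthonormal, tangent to $S^3$ along the curve, $T$ the unit tangent) with $\overline{\nabla}_TT=\kappa N$, $\overline{\nabla}_TN=-\kappa T+\tau B$, $\overline{\nabla}_TB=-\tau N$; $\tau$ is the torsion. The principal normal geodesic of $\alpha$ at $\alpha(s)$ is the great circle $u\mapsto\cos(u)\alpha(s)+\sin(u)N_\alpha(s)$; the binormal geodesic of $\beta$ at $\beta(\sigma)$ is the great circle $u\mapsto\cos(u)\beta(\sigma)+\sin(u)B_\beta(\sigma)$, $u\in\mathbb{R}$. An immersed curve $\alpha=\alpha(s)$, $s\in I$, in $S^3$ with nowhere zero curvature $\kappa_\alpha$ is a Mannheim curve if there are another immersed curve $\beta=\beta(\sigma)$, $\sigma\in J$, in $S^3$ (with nowhere zero curvature $\kappa_\beta$, so that its Frenet frame is defined) and a one-to-one correspondence $\sigma\leftrightarrow s(\sigma)$ between them (a diffeomorphism $J\to I$) such that at corresponding points $\alpha(s(\sigma))$ and $\beta(\sigma)$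 the principal normal geodesic of $\alpha$ coincides (as a great circle) with the binormal geodesic of $\beta$. Then $\alpha,\beta$ are called a pair of Mannheim curves. *)

theory Defs
  imports "HOL-Analysis.Analysis"
begin

abbreviation S3 :: "(real^4) set" where
  "S3 \<equiv> sphere 0 1"

definition open_interval :: "real set \<Rightarrow> bool" where
  "open_interval I \<longleftrightarrow> open I \<and> is_interval I \<and> I \<noteq> {}"

abbreviation vderiv :: "(real \<Rightarrow> 'a::real_normed_vector) \<Rightarrow> real \<Rightarrow> 'a" where
  "vderiv f \<equiv> (\<lambda>t. vector_derivative f (at t))"

text \<open>Infinite differentiability; only used for open \<open>I\<close>.\<close>

definition smooth_on :: "real set \<Rightarrow> (real \<Rightarrow> 'a::real_normed_vector) \<Rightarrow> bool" where
  "smooth_on I f \<longleftrightarrow> (\<forall>n. (vderiv ^^ n) f differentiable_on I)"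

definition diffeo :: "real set \<Rightarrow> real set \<Rightarrow> (real \<Rightarrow> real) \<Rightarrow> bool" where
  "diffeo J I \<phi> \<longleftrightarrow>
     bij_betw \<phi> J I \<and> smooth_on J \<phi> \<and> smooth_on I (inv_into J \<phi>)"

text \<open>Unit speed includes that the curve is immersed.\<close>

definition arclength_curve :: "real set \<Rightarrow> (real \<Rightarrow> real^4) \<Rightarrow> bool" where
  "arclength_curve I \<gamma> \<longleftrightarrow>
     open_interval I \<and> smooth_on I \<gamma> \<and> \<gamma> ` I \<subseteq> S3 \<and> (\<forall>s\<in>I. norm (vderiv \<gamma> s) = 1)"

text \<open>The Levi-Civita derivative of a vector field \<open>V\<close> along a curve \<open>\<gamma>\<close> in the sphere is the
  orthogonal projection of the Euclidean derivative of \<open>V\<close> to the tangent space \<open>\<gamma>(s)\<^sup>\<bottom>\<close>.\<close>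

definition cov_deriv :: "(real \<Rightarrow> real^4) \<Rightarrow> (real \<Rightarrow> real^4) \<Rightarrow> real \<Rightarrow> real^4" where
  "cov_deriv \<gamma> V s = vderiv V s - (vderiv V s \<bullet> \<gamma> s) *\<^sub>R \<gamma> s"

text \<open>The positivity of \<open>\<kappa>\<close> makes it the norm of \<open>cov_deriv \<gamma> T\<close>, so a frame exists only if the
  curvature vanishes nowhere, and \<open>T\<close>, \<open>N\<close>, \<open>\<kappa>\<close> are then determined on \<open>I\<close> by the curve. No
  orientation of the sphere is fixed: the pair \<open>B\<close>, \<open>\<tau>\<close> is determined up to a common sign.\<close>

definition frenet_frame ::
  "real set \<Rightarrow> (real \<Rightarrow> real^4) \<Rightarrow> (real \<Rightarrow> real^4) \<Rightarrow> (real \<Rightarrow> real^4) \<Rightarrow> (real \<Rightarrow> real^4) \<Rightarrow>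
     (real \<Rightarrow> real) \<Rightarrow> (real \<Rightarrow> real) \<Rightarrow> bool" where
  "frenet_frame I \<gamma> T N B \<kappa> \<tau> \<longleftrightarrow>
     smooth_on I T \<and> smooth_on I N \<and> smooth_on I B \<and>
     (\<forall>s\<in>I.
        T s = vderiv \<gamma> s \<and>
        T s \<bullet> \<gamma> s = 0 \<and> N s \<bullet> \<gamma> s = 0 \<and> B s \<bullet> \<gamma> s = 0 \<and>
        norm (T s) = 1 \<and> norm (N s) = 1 \<and> norm (B s) = 1 \<and>
        T s \<bullet> N s = 0 \<and> T s \<bullet> B s = 0 \<and> N s \<bullet> B s = 0 \<and>
        \<kappa> s > 0 \<and>
        cov_deriv \<gamma> T s = \<kappa> s *\<^sub>R N s \<and>
        cov_deriv \<gamma> N s = - \<kappa> s *\<^sub>R T s + \<tau> s *\<^sub>R B s \<and>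
        cov_deriv \<gamma> B s = - \<tau> s *\<^sub>R N s)"

definition great_circle :: "real^4 \<Rightarrow> real^4 \<Rightarrow> (real^4) set" where
  "great_circle p v = range (\<lambda>u::real. cos u *\<^sub>R p + sin u *\<^sub>R v)"

text \<open>The two great circles do not depend on the choice of the frames, since \<open>N\<close> is determined
  and \<open>B\<close> is determined up to sign.\<close>

definition mannheim_pair ::
  "real set \<Rightarrow> (real \<Rightarrow> real^4) \<Rightarrow> real set \<Rightarrow> (real \<Rightarrow> real^4) \<Rightarrow> bool" where
  "mannheim_pair I \<alpha> J \<beta> \<longleftrightarrow>
     arclength_curve I \<alpha> \<and> arclength_curve J \<beta> \<and>
     (\<exists>T\<^sub>\<alpha> N\<^sub>\<alpha> B\<^sub>\<alpha> \<kappa>\<^sub>\<alpha> \<tau>\<^sub>\<alpha> T\<^sub>\<beta> N\<^sub>\<beta> B\<^sub>\<beta> \<kappa>\<^sub>\<beta> \<tau>\<^sub>\<beta> \<phi>.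
        frenet_frame I \<alpha> T\<^sub>\<alpha> N\<^sub>\<alpha> B\<^sub>\<alpha> \<kappa>\<^sub>\<alpha> \<tau>\<^sub>\<alpha> \<and> frenet_frame J \<beta> T\<^sub>\<beta> N\<^sub>\<beta> B\<^sub>\<beta> \<kappa>\<^sub>\<beta> \<tau>\<^sub>\<beta> \<and>
        diffeo J I \<phi> \<and>
        (\<forall>\<sigma>\<in>J. great_circle (\<alpha> (\<phi> \<sigma>)) (N\<^sub>\<alpha> (\<phi> \<sigma>)) = great_circle (\<beta> \<sigma>) (B\<^sub>\<beta> \<sigma>)))"

end

theory Submission
  imports Defs
begin

text \<open>
  Write \<open>T, N, B, \<kappa>, \<tau>\<close> for the Frenet data of \<open>\<alpha>\<close>, evaluated at the point of \<open>\<alpha>\<close> that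
  corresponds to a point of \<open>\<beta>\<close>. Coincidence of the great circles means that \<open>\<beta>\<close> and its binormal
  \<open>B\<^sub>\<beta>\<close> form an orthonormal basis of the plane spanned by \<open>\<alpha>\<close> and \<open>N\<close>. In particular
  \<open>\<beta> = c \<alpha> + d N\<close> and \<open>B\<^sub>\<beta> = e \<alpha> + f N\<close> for functions \<open>c, d, e, f\<close>, where \<open>(e, f) = \<plusminus>(- d, c)\<close> and
  \<open>c\<^sup>2 + d\<^sup>2 = 1\<close>. The derivatives of \<open>\<beta>\<close> and \<open>B\<^sub>\<beta>\<close> are multiples of \<open>T\<^sub>\<beta>\<close> and \<open>N\<^sub>\<beta>\<close>, both
  orthogonal to that plane; hence the coefficients are constant (\<open>rigid_in_normal_plane\<close>) and, up to
  the speed of the correspondence,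
  \<open>T\<^sub>\<beta> \<sim> (c - d \<kappa>) T + d \<tau> B\<close> and \<open>- \<tau>\<^sub>\<beta> N\<^sub>\<beta> \<sim> \<plusminus>(- (d + c \<kappa>) T + c \<tau> B)\<close>.

  Orthogonality of these two vectors is the relation \<open>(d + c \<kappa>) (c - d \<kappa>) = c d \<tau>\<^sup>2\<close>. As \<open>\<kappa> > 0\<close>,
  it excludes \<open>c = 0\<close> and \<open>d = 0\<close>. It also excludes \<open>c - d \<kappa> = 0\<close>, since then \<open>\<tau> = 0\<close> and \<open>T\<^sub>\<beta>\<close>
  would vanish. Division by \<open>d (c - d \<kappa>)\<close> gives \<open>1 = \<lambda> \<kappa> + \<mu> \<tau>\<close> with \<open>\<lambda> = - c / d\<close> and
  \<open>\<mu> = c \<tau> / (c - d \<kappa>)\<close>.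

  If \<open>\<mu>\<close> were constant, then \<open>T\<^sub>\<beta>\<close> would be parallel to \<open>T + k B\<close> with a constant \<open>k\<close>. The derivative
  of \<open>T + k B\<close> lies in the plane of \<open>\<alpha>\<close> and \<open>N\<close>, so \<open>\<beta>\<close> would have no curvature in the direction
  \<open>N\<^sub>\<beta>\<close>, against \<open>\<kappa>\<^sub>\<beta> > 0\<close> (\<open>rectifying_direction_not_fixed\<close>).
\<close>

section \<open>Smooth functions on an open set of reals\<close>

text \<open>
  Smoothness does not pass to sums, products and reciprocals by induction, because the derivative
  is no simpler than the function. The finite levels of differentiability do, by induction on the
  level. Level \<open>n\<close> means that the derivatives of order up to \<open>n\<close> exist and are differentiable.
\<close>

primrec ndiff_on :: "nat \<Rightarrow> real set \<Rightarrow> (real \<Rightarrow> 'a::real_normed_vector) \<Rightarrow> bool" where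
  "ndiff_on 0 I f \<longleftrightarrow> f differentiable_on I"
| "ndiff_on (Suc n) I f \<longleftrightarrow> f differentiable_on I \<and> ndiff_on n I (vderiv f)"

lemma differentiable_on_imp_has_vderiv:
  assumes "open I" "f differentiable_on I" "x \<in> I"
  shows "(f has_vector_derivative vderiv f x) (at x)"
  using assms by (metis at_within_open differentiable_on_def vector_derivative_works)

lemma has_vector_derivative_imp_differentiable_on:
  assumes "\<And>x. x \<in> I \<Longrightarrow> (f has_vector_derivative f' x) (at x)"
  shows "f differentiable_on I"
  by (meson assms differentiableI_vector differentiable_at_imp_differentiable_on)

lemma ndiff_on_imp_differentiable_on: "ndiff_on n I f \<Longrightarrow> f differentiable_on I"
  by (cases n) auto

lemma ndiff_on_SucD: "ndiff_on (Suc n) I f \<Longrightarrow> ndiff_on n I f"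
  by (induction n arbitrary: f) (auto dest: ndiff_on_imp_differentiable_on)

lemma smooth_on_iff_ndiff_on: "smooth_on I f \<longleftrightarrow> (\<forall>n. ndiff_on n I f)"
proof
  have "ndiff_on n I f" if "\<forall>k\<le>n. (vderiv ^^ k) f differentiable_on I" for n and f :: "real \<Rightarrow> 'a"
    using that
  proof (induction n arbitrary: f)
    case (Suc n)
    have "(vderiv ^^ k) (vderiv f) differentiable_on I" if "k \<le> n" for k
      using Suc.prems[rule_format, of "Suc k"] that by (simp add: funpow_Suc_right del: funpow.simps)
    moreover have "f differentiable_on I"
      using Suc.prems[rule_format, of 0] by simp
    ultimately show ?case
      using Suc.IH by simp
  qed auto
  then show "smooth_on I f \<Longrightarrow> \<forall>n. ndiff_on n I f"
    by (simp add: smooth_on_def)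
next
  have "(vderiv ^^ n) f differentiable_on I" if "ndiff_on n I f" for n and f :: "real \<Rightarrow> 'a"
    using that by (induction n arbitrary: f) (simp_all add: funpow_Suc_right del: funpow.simps(2))
  then show "\<forall>n. ndiff_on n I f \<Longrightarrow> smooth_on I f"
    by (simp add: smooth_on_def)
qed

lemma smooth_on_imp_has_vderiv:
  assumes "open I" "smooth_on I f" "x \<in> I"
  shows "(f has_vector_derivative vderiv f x) (at x)"
  using assms by (meson ndiff_on_imp_differentiable_on differentiable_on_imp_has_vderiv smooth_on_iff_ndiff_on)

lemma smooth_on_vderiv: "smooth_on I f \<Longrightarrow> smooth_on I (vderiv f)"
  unfolding smooth_on_iff_ndiff_on by (metis ndiff_on.simps(2))

lemma has_vector_derivative_cong_open:
  assumes "open I" "x \<in> I" "\<And>y. y \<in> I \<Longrightarrow> f y = g y"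
  shows "(f has_vector_derivative D) (at x) \<longleftrightarrow> (g has_vector_derivative D) (at x)"
  using assms by (metis has_vector_derivative_transform_within_open)

lemma vderiv_cong_open:
  assumes "open I" "x \<in> I" "\<And>y. y \<in> I \<Longrightarrow> f y = g y"
  shows "vderiv f x = vderiv g x"
  unfolding vector_derivative_def using has_vector_derivative_cong_open[OF assms] by simp

lemma differentiable_on_cong:
  assumes "\<And>x. x \<in> I \<Longrightarrow> f x = g x"
  shows "f differentiable_on I \<longleftrightarrow> g differentiable_on I"
  unfolding differentiable_on_def differentiable_def
  by (metis assms has_derivative_transform)

lemma ndiff_on_cong:
  assumes "open I" "\<And>x. x \<in> I \<Longrightarrow> f x = g x"
  shows "ndiff_on n I f \<longleftrightarrow> ndiff_on n I g"
  using assms(2)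
proof (induction n arbitrary: f g)
  case 0
  then show ?case using differentiable_on_cong[of I f g] by simp
next
  case (Suc n)
  have "vderiv f x = vderiv g x" if "x \<in> I" for x
    using vderiv_cong_open[OF assms(1) that] Suc.prems by blast
  with Suc.IH[of "vderiv f" "vderiv g"] differentiable_on_cong[of I f g] Suc.prems
  show ?case by simp
qed

lemma smooth_on_cong:
  assumes "open I" "\<And>x. x \<in> I \<Longrightarrow> f x = g x"
  shows "smooth_on I f \<longleftrightarrow> smooth_on I g"
  unfolding smooth_on_iff_ndiff_on using ndiff_on_cong[of I f g] assms by simp

lemma ndiff_on_SucI:
  assumes "open I" "\<And>x. x \<in> I \<Longrightarrow> (f has_vector_derivative f' x) (at x)" "ndiff_on n I f'"
  shows "ndiff_on (Suc n) I f"
proof -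
  have "vderiv f x = f' x" if "x \<in> I" for x
    using assms(2) that by (simp add: vector_derivative_at)
  then have "ndiff_on n I (vderiv f)"
    using ndiff_on_cong[of I "vderiv f" f' n] assms(1,3) by simp
  then show ?thesis
    using has_vector_derivative_imp_differentiable_on[of I f f'] assms(2) by simp
qed

lemma ndiff_on_const: "ndiff_on n I (\<lambda>_. c)"
  by (induction n arbitrary: c) (auto simp: vector_derivative_const_at)

lemma ndiff_on_add:
  assumes "open I" "ndiff_on n I f" "ndiff_on n I g"
  shows "ndiff_on n I (\<lambda>x. f x + g x)"
  using assms(2,3)
proof (induction n arbitrary: f g)
  case (Suc n)
  show ?case
  proof (rule ndiff_on_SucI[OF assms(1)])
    show "ndiff_on n I (\<lambda>x. vderiv f x + vderiv g x)"
      using Suc by simp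
    show "((\<lambda>x. f x + g x) has_vector_derivative vderiv f x + vderiv g x) (at x)" if "x \<in> I" for x
      using Suc.prems that
      by (intro has_vector_derivative_add differentiable_on_imp_has_vderiv[OF assms(1)]) simp_all
  qed
qed (simp add: differentiable_on_add)

text \<open>
  By the product rule, the derivative is a sum of two terms of the same form. One statement
  covers multiplication of scalars and the inner product.
\<close>

lemma ndiff_on_bilinear:
  assumes "open I" "bounded_bilinear h" "ndiff_on n I f" "ndiff_on n I g"
  shows "ndiff_on n I (\<lambda>x. h (f x) (g x))"
proof -
  have product_rule: "((\<lambda>x. h (f x) (g x)) has_vector_derivative
      h (f x) (vderiv g x) + h (vderiv f x) (g x)) (at x)"
    if "f differentiable_on I" "g differentiable_on I" "x \<in> I" for f g x
    using bounded_bilinear.has_vector_derivative[OF assms(2)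
        differentiable_on_imp_has_vderiv[OF assms(1) that(1,3)]
        differentiable_on_imp_has_vderiv[OF assms(1) that(2,3)]] .
  show ?thesis
    using assms(3,4)
  proof (induction n arbitrary: f g)
    case 0
    then show ?case
      using has_vector_derivative_imp_differentiable_on[OF product_rule[of f g]] by simp
  next
    case (Suc n)
    show ?case
    proof (rule ndiff_on_SucI[OF assms(1)])
      show "ndiff_on n I (\<lambda>x. h (f x) (vderiv g x) + h (vderiv f x) (g x))"
        using Suc.prems ndiff_on_SucD[of n I f] ndiff_on_SucD[of n I g]
        by (intro ndiff_on_add assms(1) Suc.IH) auto
    qed (use Suc.prems product_rule[of f g] in auto)
  qed
qed

text \<open>
  The derivative of \<open>1 / f\<close> is a product of \<open>f'\<close> and copies of \<open>1 / f\<close>, which have the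
  preceding level by induction.
\<close>

lemma ndiff_on_inverse:
  fixes f :: "real \<Rightarrow> real"
  assumes "open I" "ndiff_on n I f" "\<And>x. x \<in> I \<Longrightarrow> f x \<noteq> 0"
  shows "ndiff_on n I (\<lambda>x. inverse (f x))"
  using assms(2)
proof (induction n)
  case 0
  then show ?case
    using assms(3) by (auto simp: differentiable_on_def intro!: differentiable_inverse)
next
  case (Suc n)
  let ?r = "\<lambda>x. inverse (f x)"
  note mult = ndiff_on_bilinear[OF assms(1) bounded_bilinear_mult]
  have "ndiff_on n I ?r"
    using Suc ndiff_on_SucD[of n I f] by simp
  show ?case
  proof (rule ndiff_on_SucI[OF assms(1)])
    show "ndiff_on n I (\<lambda>x. -1 * (?r x * vderiv f x * ?r x))"
      using Suc.prems \<open>ndiff_on n I ?r\<close> by (intro mult ndiff_on_const) simp_all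
    show "(?r has_vector_derivative -1 * (?r x * vderiv f x * ?r x)) (at x)" if "x \<in> I" for x
      using differentiable_on_imp_has_vderiv[OF assms(1) ndiff_on_imp_differentiable_on[OF Suc.prems] that]
        DERIV_inverse'[of f "vderiv f x" x UNIV] assms(3)[OF that]
      by (simp add: has_real_derivative_iff_has_vector_derivative)
  qed
qed

section \<open>Frenet frames in the sphere\<close>

lemma frenet_orthonormal:
  assumes "arclength_curve I \<gamma>" "frenet_frame I \<gamma> T N B \<kappa> \<tau>" "s \<in> I"
  shows "\<gamma> s \<bullet> \<gamma> s = 1" "T s \<bullet> T s = 1" "N s \<bullet> N s = 1" "B s \<bullet> B s = 1"
    "T s \<bullet> \<gamma> s = 0" "N s \<bullet> \<gamma> s = 0" "B s \<bullet> \<gamma> s = 0" "\<gamma> s \<bullet> T s = 0" "\<gamma> s \<bullet> N s = 0" "\<gamma> s \<bullet> B s = 0"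
    "T s \<bullet> N s = 0" "T s \<bullet> B s = 0" "N s \<bullet> B s = 0" "N s \<bullet> T s = 0" "B s \<bullet> T s = 0" "B s \<bullet> N s = 0"
proof -
  have "norm (\<gamma> s) = 1"
    using assms(1,3) by (auto simp: arclength_curve_def)
  moreover have "norm (T s) = 1" "norm (N s) = 1" "norm (B s) = 1"
    "T s \<bullet> \<gamma> s = 0" "N s \<bullet> \<gamma> s = 0" "B s \<bullet> \<gamma> s = 0" "T s \<bullet> N s = 0" "T s \<bullet> B s = 0" "N s \<bullet> B s = 0"
    using assms(2,3) unfolding frenet_frame_def by blast+
  ultimately show "\<gamma> s \<bullet> \<gamma> s = 1" "T s \<bullet> T s = 1" "N s \<bullet> N s = 1" "B s \<bullet> B s = 1"
    "T s \<bullet> \<gamma> s = 0" "N s \<bullet> \<gamma> s = 0" "B s \<bullet> \<gamma> s = 0" "\<gamma> s \<bullet> T s = 0" "\<gamma> s \<bullet> N s = 0" "\<gamma> s \<bullet> B s = 0"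
    "T s \<bullet> N s = 0" "T s \<bullet> B s = 0" "N s \<bullet> B s = 0" "N s \<bullet> T s = 0" "B s \<bullet> T s = 0" "B s \<bullet> N s = 0"
    by (simp_all add: inner_commute norm_eq_1)
qed

text \<open>
  The Frenet equations in Euclidean terms. For a field \<open>V\<close> tangent to the sphere, differentiation of
  \<open>V \<bullet> \<gamma> = 0\<close> shows that the normal component removed by the covariant derivative is
  \<open>- (V \<bullet> T) \<gamma>\<close>, so only the equation for \<open>T\<close> acquires an additional term.
\<close>

lemma frenet_equations:
  assumes "arclength_curve I \<gamma>" "frenet_frame I \<gamma> T N B \<kappa> \<tau>" "s \<in> I"
  shows "(\<gamma> has_vector_derivative T s) (at s)"
    and "(T has_vector_derivative \<kappa> s *\<^sub>R N s - \<gamma> s) (at s)"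
    and "(N has_vector_derivative - \<kappa> s *\<^sub>R T s + \<tau> s *\<^sub>R B s) (at s)"
    and "(B has_vector_derivative - \<tau> s *\<^sub>R N s) (at s)"
proof -
  have I: "open I" and "smooth_on I \<gamma>"
    using assms(1) by (auto simp: arclength_curve_def open_interval_def)
  have sm: "smooth_on I T" "smooth_on I N" "smooth_on I B"
    and "T s = vderiv \<gamma> s" and cov: "cov_deriv \<gamma> T s = \<kappa> s *\<^sub>R N s"
      "cov_deriv \<gamma> N s = - \<kappa> s *\<^sub>R T s + \<tau> s *\<^sub>R B s" "cov_deriv \<gamma> B s = - \<tau> s *\<^sub>R N s"
    using assms(2,3) unfolding frenet_frame_def by blast+
  note on = frenet_orthonormal[OF assms(1,2)]
  show \<gamma>: "(\<gamma> has_vector_derivative T s) (at s)"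
    using smooth_on_imp_has_vderiv[OF I \<open>smooth_on I \<gamma>\<close> assms(3)] \<open>T s = vderiv \<gamma> s\<close> by simp
  have tangential: "vderiv V s = cov_deriv \<gamma> V s - (V s \<bullet> T s) *\<^sub>R \<gamma> s"
    if V: "smooth_on I V" "\<And>t. t \<in> I \<Longrightarrow> V t \<bullet> \<gamma> t = 0" for V
  proof -
    have "((\<lambda>t. V t \<bullet> \<gamma> t) has_vector_derivative V s \<bullet> T s + vderiv V s \<bullet> \<gamma> s) (at s)"
      by (rule bounded_bilinear.has_vector_derivative[OF bounded_bilinear_inner
            smooth_on_imp_has_vderiv[OF I V(1) assms(3)] \<gamma>])
    moreover have "((\<lambda>t. V t \<bullet> \<gamma> t) has_vector_derivative 0) (at s)"
      using has_vector_derivative_cong_open[OF I assms(3), of "\<lambda>t. V t \<bullet> \<gamma> t" "\<lambda>_. 0"] V(2) by simp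
    ultimately have "V s \<bullet> T s + vderiv V s \<bullet> \<gamma> s = 0"
      using vector_derivative_unique_at by blast
    then have "vderiv V s \<bullet> \<gamma> s = - (V s \<bullet> T s)" by simp
    then show ?thesis
      unfolding cov_deriv_def by simp
  qed
  have "vderiv T s = \<kappa> s *\<^sub>R N s - \<gamma> s"
    using tangential[OF sm(1) on(5)] cov(1) on[OF assms(3)] by simp
  then show "(T has_vector_derivative \<kappa> s *\<^sub>R N s - \<gamma> s) (at s)"
    using smooth_on_imp_has_vderiv[OF I sm(1) assms(3)] by simp
  have "vderiv N s = - \<kappa> s *\<^sub>R T s + \<tau> s *\<^sub>R B s"
    using tangential[OF sm(2) on(6)] cov(2) on[OF assms(3)] by simp
  then show "(N has_vector_derivative - \<kappa> s *\<^sub>R T s + \<tau> s *\<^sub>R B s) (at s)"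
    using smooth_on_imp_has_vderiv[OF I sm(2) assms(3)] by simp
  have "vderiv B s = - \<tau> s *\<^sub>R N s"
    using tangential[OF sm(3) on(7)] cov(3) on[OF assms(3)] by simp
  then show "(B has_vector_derivative - \<tau> s *\<^sub>R N s) (at s)"
    using smooth_on_imp_has_vderiv[OF I sm(3) assms(3)] by simp
qed

text \<open>
  The frame that witnesses the Mannheim property may differ from a given one; its principal
  normals, hence the great circles, do not.
\<close>

lemma frenet_normal_unique:
  assumes "arclength_curve I \<gamma>" "frenet_frame I \<gamma> T N B \<kappa> \<tau>" "frenet_frame I \<gamma> T' N' B' \<kappa>' \<tau>'"
    "s \<in> I"
  shows "N s = N' s"
proof -
  have I: "open I"
    using assms(1) by (auto simp: arclength_curve_def open_interval_def)
  have "T t = T' t" if "t \<in> I" for t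
    using assms(2,3) that by (simp add: frenet_frame_def)
  then have "(T has_vector_derivative \<kappa>' s *\<^sub>R N' s - \<gamma> s) (at s)"
    using frenet_equations(2)[OF assms(1,3,4)] has_vector_derivative_cong_open[OF I assms(4), of T T'] by blast
  then have *: "\<kappa> s *\<^sub>R N s = \<kappa>' s *\<^sub>R N' s"
    using frenet_equations(2)[OF assms(1,2,4)] vector_derivative_unique_at by fastforce
  have unit: "\<kappa> s > 0" "\<kappa>' s > 0" "norm (N s) = 1" "norm (N' s) = 1"
    using assms(2-4) by (auto simp: frenet_frame_def)
  have "norm (\<kappa> s *\<^sub>R N s) = norm (\<kappa>' s *\<^sub>R N' s)"
    using * by simp
  then have "\<kappa> s = \<kappa>' s"
    using unit by simp
  with * unit show ?thesis by simp
qed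

text \<open>
  A Frenet frame has smooth vector fields by definition; \<open>\<kappa>\<close> and \<open>\<tau>\<close> are inner products of these
  fields and their derivatives.
\<close>

lemma frenet_curvatures_smooth:
  assumes "arclength_curve I \<gamma>" "frenet_frame I \<gamma> T N B \<kappa> \<tau>"
  shows "smooth_on I \<kappa>" "smooth_on I \<tau>"
proof -
  have I: "open I"
    using assms(1) by (auto simp: arclength_curve_def open_interval_def)
  have sm: "smooth_on I T" "smooth_on I N" "smooth_on I B"
    using assms(2) by (auto simp: frenet_frame_def)
  have "vderiv T s \<bullet> N s = \<kappa> s" "vderiv N s \<bullet> B s = \<tau> s" if "s \<in> I" for s
    using frenet_equations(2,3)[OF assms that, THEN vector_derivative_at] frenet_orthonormal[OF assms that]
    by (simp_all add: inner_simps)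
  moreover have "smooth_on I (\<lambda>s. vderiv T s \<bullet> N s)" "smooth_on I (\<lambda>s. vderiv N s \<bullet> B s)"
    using sm smooth_on_vderiv ndiff_on_bilinear[OF I bounded_bilinear_inner]
    unfolding smooth_on_iff_ndiff_on by blast+
  ultimately show "smooth_on I \<kappa>" "smooth_on I \<tau>"
    using smooth_on_cong[OF I] by (metis (lifting))+
qed

section \<open>Curves moving with the normal plane of another curve\<close>

text \<open>
  The parameters \<open>0\<close> and \<open>\<pi> / 2\<close> show that \<open>q\<close> and \<open>w\<close> are points of the common circle, which lies
  in the plane of \<open>p\<close> and \<open>v\<close>.
\<close>

lemma great_circle_eqD:
  assumes eq: "great_circle p v = great_circle q w"
    and "p \<bullet> p = 1" "v \<bullet> v = 1" "p \<bullet> v = 0"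
  shows "q = (q \<bullet> p) *\<^sub>R p + (q \<bullet> v) *\<^sub>R v" and "w = (w \<bullet> p) *\<^sub>R p + (w \<bullet> v) *\<^sub>R v"
proof -
  have "q \<in> great_circle q w" "w \<in> great_circle q w"
    using rangeI[of "\<lambda>u. cos u *\<^sub>R q + sin u *\<^sub>R w" 0]
      rangeI[of "\<lambda>u. cos u *\<^sub>R q + sin u *\<^sub>R w" "pi/2"]
    by (simp_all add: great_circle_def)
  then have "q \<in> great_circle p v" "w \<in> great_circle p v"
    using eq by simp_all
  moreover have "z = (z \<bullet> p) *\<^sub>R p + (z \<bullet> v) *\<^sub>R v" if "z \<in> great_circle p v" for z
    using that assms(2-4) by (auto simp: great_circle_def inner_simps inner_commute[of v p])
  ultimately show "q = (q \<bullet> p) *\<^sub>R p + (q \<bullet> v) *\<^sub>R v" "w = (w \<bullet> p) *\<^sub>R p + (w \<bullet> v) *\<^sub>R v"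
    by blast+
qed

lemma zero_derivative_imp_constant:
  assumes "open_interval J" "\<And>x. x \<in> J \<Longrightarrow> (f has_vector_derivative 0) (at x)"
  shows "\<exists>c. \<forall>x\<in>J. f x = c"
proof (rule has_vector_derivative_zero_constant)
  show "convex J"
    using assms(1) by (simp add: open_interval_def is_interval_convex)
  show "(f has_vector_derivative 0) (at x within J)" if "x \<in> J" for x
    using assms(2)[OF that] by (rule has_vector_derivative_at_within)
qed blast

text \<open>
  A vector \<open>X\<close> in the plane of \<open>\<alpha>\<close> and \<open>N\<close> whose derivative is orthogonal to this plane has constant
  coordinates: the derivatives of \<open>\<alpha>\<close> and \<open>N\<close> are combinations of \<open>T\<close> and \<open>B\<close>, to which \<open>X\<close> is
  orthogonal. It will be used for the curve \<open>\<beta>\<close> and for its binormal.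
\<close>

lemma rigid_in_normal_plane:
  assumes \<alpha>: "arclength_curve I \<alpha>" "frenet_frame I \<alpha> T N B \<kappa> \<tau>"
    and J: "open_interval J" and \<phi>J: "\<phi> ` J \<subseteq> I"
    and \<phi>: "\<And>\<sigma>. \<sigma> \<in> J \<Longrightarrow> (\<phi> has_vector_derivative \<phi>' \<sigma>) (at \<sigma>)"
    and X: "\<And>\<sigma>. \<sigma> \<in> J \<Longrightarrow> (X has_vector_derivative X' \<sigma>) (at \<sigma>)"
    and plane: "\<And>\<sigma>. \<sigma> \<in> J \<Longrightarrow>
      X \<sigma> = (X \<sigma> \<bullet> \<alpha> (\<phi> \<sigma>)) *\<^sub>R \<alpha> (\<phi> \<sigma>) + (X \<sigma> \<bullet> N (\<phi> \<sigma>)) *\<^sub>R N (\<phi> \<sigma>)"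
    and perp: "\<And>\<sigma>. \<sigma> \<in> J \<Longrightarrow> X' \<sigma> \<bullet> \<alpha> (\<phi> \<sigma>) = 0" "\<And>\<sigma>. \<sigma> \<in> J \<Longrightarrow> X' \<sigma> \<bullet> N (\<phi> \<sigma>) = 0"
  obtains c d where
    "\<And>\<sigma>. \<sigma> \<in> J \<Longrightarrow> X \<sigma> = c *\<^sub>R \<alpha> (\<phi> \<sigma>) + d *\<^sub>R N (\<phi> \<sigma>)"
    "\<And>\<sigma>. \<sigma> \<in> J \<Longrightarrow> X' \<sigma> =
       \<phi>' \<sigma> *\<^sub>R ((c - d * \<kappa> (\<phi> \<sigma>)) *\<^sub>R T (\<phi> \<sigma>) + (d * \<tau> (\<phi> \<sigma>)) *\<^sub>R B (\<phi> \<sigma>))"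
proof -
  have oJ: "open J"
    using J by (simp add: open_interval_def)
  have d\<alpha>: "((\<lambda>\<sigma>. \<alpha> (\<phi> \<sigma>)) has_vector_derivative \<phi>' \<sigma> *\<^sub>R T (\<phi> \<sigma>)) (at \<sigma>)"
    and dN: "((\<lambda>\<sigma>. N (\<phi> \<sigma>)) has_vector_derivative
               \<phi>' \<sigma> *\<^sub>R (- \<kappa> (\<phi> \<sigma>) *\<^sub>R T (\<phi> \<sigma>) + \<tau> (\<phi> \<sigma>) *\<^sub>R B (\<phi> \<sigma>))) (at \<sigma>)"
    if "\<sigma> \<in> J" for \<sigma>
    using vector_diff_chain_at[OF \<phi>[OF that]] frenet_equations(1,3)[OF \<alpha>, of "\<phi> \<sigma>"] that \<phi>J
    by (auto simp: o_def image_subset_iff)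
  have XTB: "X \<sigma> \<bullet> T (\<phi> \<sigma>) = 0" "X \<sigma> \<bullet> B (\<phi> \<sigma>) = 0" if "\<sigma> \<in> J" for \<sigma>
    using frenet_orthonormal[OF \<alpha>, of "\<phi> \<sigma>"] that \<phi>J
    by (subst plane[OF that]; simp add: inner_simps image_subset_iff)+
  have "((\<lambda>\<sigma>. X \<sigma> \<bullet> \<alpha> (\<phi> \<sigma>)) has_vector_derivative 0) (at \<sigma>)" if "\<sigma> \<in> J" for \<sigma>
    using bounded_bilinear.has_vector_derivative[OF bounded_bilinear_inner X[OF that] d\<alpha>[OF that]]
      perp[OF that] XTB[OF that] by (simp add: inner_simps)
  from zero_derivative_imp_constant[OF J this]
  obtain c where c: "\<And>\<sigma>. \<sigma> \<in> J \<Longrightarrow> X \<sigma> \<bullet> \<alpha> (\<phi> \<sigma>) = c"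
    by blast
  have "((\<lambda>\<sigma>. X \<sigma> \<bullet> N (\<phi> \<sigma>)) has_vector_derivative 0) (at \<sigma>)" if "\<sigma> \<in> J" for \<sigma>
    using bounded_bilinear.has_vector_derivative[OF bounded_bilinear_inner X[OF that] dN[OF that]]
      perp[OF that] XTB[OF that] by (simp add: inner_simps)
  from zero_derivative_imp_constant[OF J this]
  obtain d where d: "\<And>\<sigma>. \<sigma> \<in> J \<Longrightarrow> X \<sigma> \<bullet> N (\<phi> \<sigma>) = d"
    by blast
  have Xcd: "X \<sigma> = c *\<^sub>R \<alpha> (\<phi> \<sigma>) + d *\<^sub>R N (\<phi> \<sigma>)" if "\<sigma> \<in> J" for \<sigma>
    using plane[OF that] c[OF that] d[OF that] by simp
  have "X' \<sigma> = \<phi>' \<sigma> *\<^sub>R ((c - d * \<kappa> (\<phi> \<sigma>)) *\<^sub>R T (\<phi> \<sigma>) + (d * \<tau> (\<phi> \<sigma>)) *\<^sub>R B (\<phi> \<sigma>))"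
    if "\<sigma> \<in> J" for \<sigma>
  proof -
    have "((\<lambda>\<sigma>. c *\<^sub>R \<alpha> (\<phi> \<sigma>) + d *\<^sub>R N (\<phi> \<sigma>)) has_vector_derivative
        c *\<^sub>R \<phi>' \<sigma> *\<^sub>R T (\<phi> \<sigma>) +
        d *\<^sub>R \<phi>' \<sigma> *\<^sub>R (- \<kappa> (\<phi> \<sigma>) *\<^sub>R T (\<phi> \<sigma>) + \<tau> (\<phi> \<sigma>) *\<^sub>R B (\<phi> \<sigma>))) (at \<sigma>)"
      by (rule has_vector_derivative_add[OF
            bounded_linear.has_vector_derivative[OF bounded_linear_scaleR_right d\<alpha>[OF that]]
            bounded_linear.has_vector_derivative[OF bounded_linear_scaleR_right dN[OF that]]])
    then have "(X has_vector_derivative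
        c *\<^sub>R \<phi>' \<sigma> *\<^sub>R T (\<phi> \<sigma>) +
        d *\<^sub>R \<phi>' \<sigma> *\<^sub>R (- \<kappa> (\<phi> \<sigma>) *\<^sub>R T (\<phi> \<sigma>) + \<tau> (\<phi> \<sigma>) *\<^sub>R B (\<phi> \<sigma>))) (at \<sigma>)"
      using has_vector_derivative_cong_open[OF oJ that Xcd] by simp
    then have "X' \<sigma> = c *\<^sub>R \<phi>' \<sigma> *\<^sub>R T (\<phi> \<sigma>) +
        d *\<^sub>R \<phi>' \<sigma> *\<^sub>R (- \<kappa> (\<phi> \<sigma>) *\<^sub>R T (\<phi> \<sigma>) + \<tau> (\<phi> \<sigma>) *\<^sub>R B (\<phi> \<sigma>))"
      using X[OF that] vector_derivative_unique_at by blast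
    then show ?thesis by (simp add: algebra_simps)
  qed
  with Xcd that show ?thesis by blast
qed

text \<open>
  In the derivative of \<open>T\<^sub>\<alpha> + k B\<^sub>\<alpha>\<close> with constant \<open>k\<close> only \<open>\<alpha>\<close> and \<open>N\<^sub>\<alpha>\<close> occur. If \<open>T\<^sub>\<beta>\<close> keeps this
  direction, then \<open>\<kappa>\<^sub>\<beta> N\<^sub>\<beta> - \<beta>\<close>, which is the derivative of \<open>T\<^sub>\<beta>\<close>, is a combination of \<open>\<alpha>\<close>,
  \<open>N\<^sub>\<alpha>\<close> and \<open>T\<^sub>\<beta>\<close>, all orthogonal to \<open>N\<^sub>\<beta>\<close>; taking the inner product with \<open>N\<^sub>\<beta>\<close> gives \<open>\<kappa>\<^sub>\<beta> = 0\<close>.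
\<close>

lemma rectifying_direction_not_fixed:
  assumes \<alpha>: "arclength_curve I \<alpha>" "frenet_frame I \<alpha> T\<^sub>\<alpha> N\<^sub>\<alpha> B\<^sub>\<alpha> \<kappa>\<^sub>\<alpha> \<tau>\<^sub>\<alpha>"
    and \<beta>: "arclength_curve J \<beta>" and frame_\<beta>: "frenet_frame J \<beta> T\<^sub>\<beta> N\<^sub>\<beta> B\<^sub>\<beta> \<kappa>\<^sub>\<beta> \<tau>\<^sub>\<beta>"
    and \<phi>J: "\<phi> ` J \<subseteq> I"
    and \<phi>: "\<And>\<sigma>. \<sigma> \<in> J \<Longrightarrow> (\<phi> has_vector_derivative \<phi>' \<sigma>) (at \<sigma>)"
    and \<sigma>\<^sub>0: "\<sigma>\<^sub>0 \<in> J"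
    and perp: "N\<^sub>\<beta> \<sigma>\<^sub>0 \<bullet> \<alpha> (\<phi> \<sigma>\<^sub>0) = 0" "N\<^sub>\<beta> \<sigma>\<^sub>0 \<bullet> N\<^sub>\<alpha> (\<phi> \<sigma>\<^sub>0) = 0"
    and fixed_direction:
      "\<And>\<sigma>. \<sigma> \<in> J \<Longrightarrow> T\<^sub>\<beta> \<sigma> = r \<sigma> *\<^sub>R (T\<^sub>\<alpha> (\<phi> \<sigma>) + k *\<^sub>R B\<^sub>\<alpha> (\<phi> \<sigma>))"
  shows False
proof -
  have J: "open J"
    using \<beta> by (auto simp: arclength_curve_def open_interval_def)
  have \<phi>_I: "\<phi> \<sigma> \<in> I" if "\<sigma> \<in> J" for \<sigma>
    using \<phi>J that by blast
  note on_\<beta> = frenet_orthonormal[OF \<beta> frame_\<beta>]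
  define V where "V \<sigma> = T\<^sub>\<alpha> (\<phi> \<sigma>) + k *\<^sub>R B\<^sub>\<alpha> (\<phi> \<sigma>)" for \<sigma>
  \<comment> \<open>The coefficient \<open>r\<close>, written so that its differentiability is visible.\<close>
  define g where "g \<sigma> = T\<^sub>\<beta> \<sigma> \<bullet> V \<sigma> / (1 + k * k)" for \<sigma>
  have "1 + k * k > 0"
    by (simp add: add_pos_nonneg)
  have TV: "T\<^sub>\<beta> \<sigma> = g \<sigma> *\<^sub>R V \<sigma>" if "\<sigma> \<in> J" for \<sigma>
  proof -
    have "V \<sigma> \<bullet> V \<sigma> = 1 + k * k"
      using frenet_orthonormal[OF \<alpha> \<phi>_I[OF that]] by (simp add: V_def inner_simps)
    then show ?thesis
      using \<open>1 + k * k > 0\<close> fixed_direction[OF that] by (simp add: g_def flip: V_def)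
  qed
  let ?V' = "\<phi>' \<sigma>\<^sub>0 *\<^sub>R (\<kappa>\<^sub>\<alpha> (\<phi> \<sigma>\<^sub>0) *\<^sub>R N\<^sub>\<alpha> (\<phi> \<sigma>\<^sub>0) - \<alpha> (\<phi> \<sigma>\<^sub>0)) +
    k *\<^sub>R \<phi>' \<sigma>\<^sub>0 *\<^sub>R (- \<tau>\<^sub>\<alpha> (\<phi> \<sigma>\<^sub>0) *\<^sub>R N\<^sub>\<alpha> (\<phi> \<sigma>\<^sub>0))"
  have "((\<lambda>\<sigma>. T\<^sub>\<alpha> (\<phi> \<sigma>)) has_vector_derivative
      \<phi>' \<sigma>\<^sub>0 *\<^sub>R (\<kappa>\<^sub>\<alpha> (\<phi> \<sigma>\<^sub>0) *\<^sub>R N\<^sub>\<alpha> (\<phi> \<sigma>\<^sub>0) - \<alpha> (\<phi> \<sigma>\<^sub>0))) (at \<sigma>\<^sub>0)"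
    and dB\<alpha>: "((\<lambda>\<sigma>. B\<^sub>\<alpha> (\<phi> \<sigma>)) has_vector_derivative
      \<phi>' \<sigma>\<^sub>0 *\<^sub>R (- \<tau>\<^sub>\<alpha> (\<phi> \<sigma>\<^sub>0) *\<^sub>R N\<^sub>\<alpha> (\<phi> \<sigma>\<^sub>0))) (at \<sigma>\<^sub>0)"
    using frenet_equations(2,4)[OF \<alpha> \<phi>_I[OF \<sigma>\<^sub>0], THEN vector_diff_chain_at[OF \<phi>[OF \<sigma>\<^sub>0]]]
    by (simp_all add: o_def)
  then have dV: "(V has_vector_derivative ?V') (at \<sigma>\<^sub>0)"
    unfolding V_def[abs_def]
    by (intro has_vector_derivative_add
        bounded_linear.has_vector_derivative[OF bounded_linear_scaleR_right dB\<alpha>])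
  note dT = frenet_equations(2)[OF \<beta> frame_\<beta> \<sigma>\<^sub>0]
  obtain g' where dg: "(g has_vector_derivative g') (at \<sigma>\<^sub>0)"
    unfolding g_def[abs_def] divide_inverse
    using bounded_bilinear.has_vector_derivative[OF bounded_bilinear_mult
        bounded_bilinear.has_vector_derivative[OF bounded_bilinear_inner dT dV]
        has_vector_derivative_const] by blast
  have "(T\<^sub>\<beta> has_vector_derivative g \<sigma>\<^sub>0 *\<^sub>R ?V' + g' *\<^sub>R V \<sigma>\<^sub>0) (at \<sigma>\<^sub>0)"
    using bounded_bilinear.has_vector_derivative[OF bounded_bilinear_scaleR dg dV]
      has_vector_derivative_cong_open[OF J \<sigma>\<^sub>0 TV] by simp
  then have eq: "\<kappa>\<^sub>\<beta> \<sigma>\<^sub>0 *\<^sub>R N\<^sub>\<beta> \<sigma>\<^sub>0 - \<beta> \<sigma>\<^sub>0 = g \<sigma>\<^sub>0 *\<^sub>R ?V' + g' *\<^sub>R V \<sigma>\<^sub>0"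
    using dT vector_derivative_unique_at by blast
  have "g \<sigma>\<^sub>0 \<noteq> 0"
    using TV[OF \<sigma>\<^sub>0] on_\<beta>(2)[OF \<sigma>\<^sub>0] by auto
  then have "N\<^sub>\<beta> \<sigma>\<^sub>0 \<bullet> V \<sigma>\<^sub>0 = 0"
    using TV[OF \<sigma>\<^sub>0] on_\<beta>(14)[OF \<sigma>\<^sub>0] by simp
  moreover have "N\<^sub>\<beta> \<sigma>\<^sub>0 \<bullet> \<alpha> (\<phi> \<sigma>\<^sub>0) = 0" "N\<^sub>\<beta> \<sigma>\<^sub>0 \<bullet> N\<^sub>\<alpha> (\<phi> \<sigma>\<^sub>0) = 0"
    using perp by simp_all
  ultimately have "N\<^sub>\<beta> \<sigma>\<^sub>0 \<bullet> (\<kappa>\<^sub>\<beta> \<sigma>\<^sub>0 *\<^sub>R N\<^sub>\<beta> \<sigma>\<^sub>0 - \<beta> \<sigma>\<^sub>0) = 0"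
    unfolding eq by (simp add: inner_simps)
  then have "\<kappa>\<^sub>\<beta> \<sigma>\<^sub>0 = 0"
    using on_\<beta>[OF \<sigma>\<^sub>0] by (simp add: inner_simps)
  then show False
    using frame_\<beta> \<sigma>\<^sub>0 by (auto simp: frenet_frame_def)
qed

section \<open>Mannheim pairs\<close>

theorem theorem2p3:
  fixes \<alpha> \<beta> :: "real \<Rightarrow> real^4" and I J :: "real set"
    and T\<^sub>\<alpha> N\<^sub>\<alpha> B\<^sub>\<alpha> :: "real \<Rightarrow> real^4" and \<kappa>\<^sub>\<alpha> \<tau>\<^sub>\<alpha> :: "real \<Rightarrow> real"
  assumes "mannheim_pair I \<alpha> J \<beta>"
    and "frenet_frame I \<alpha> T\<^sub>\<alpha> N\<^sub>\<alpha> B\<^sub>\<alpha> \<kappa>\<^sub>\<alpha> \<tau>\<^sub>\<alpha>"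
  shows "\<exists>(l::real) (\<mu>::real \<Rightarrow> real).
           smooth_on I \<mu> \<and> \<not> \<mu> constant_on I \<and>
           (\<forall>s\<in>I. 1 = l * \<kappa>\<^sub>\<alpha> s + \<mu> s * \<tau>\<^sub>\<alpha> s)"
proof -
  obtain T' N' B' \<kappa>' \<tau>' T\<^sub>\<beta> N\<^sub>\<beta> B\<^sub>\<beta> \<kappa>\<^sub>\<beta> \<tau>\<^sub>\<beta> \<phi> where
    \<alpha>: "arclength_curve I \<alpha>" and \<beta>: "arclength_curve J \<beta>"
    and frame': "frenet_frame I \<alpha> T' N' B' \<kappa>' \<tau>'"
    and frame_\<beta>: "frenet_frame J \<beta> T\<^sub>\<beta> N\<^sub>\<beta> B\<^sub>\<beta> \<kappa>\<^sub>\<beta> \<tau>\<^sub>\<beta>"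
    and \<phi>: "diffeo J I \<phi>"
    and circles': "\<And>\<sigma>. \<sigma> \<in> J \<Longrightarrow>
      great_circle (\<alpha> (\<phi> \<sigma>)) (N' (\<phi> \<sigma>)) = great_circle (\<beta> \<sigma>) (B\<^sub>\<beta> \<sigma>)"
    using assms(1) unfolding mannheim_pair_def by blast
  note frame = assms(2)
  have I: "open I" and J: "open J" "open_interval J" "J \<noteq> {}"
    using \<alpha> \<beta> by (auto simp: arclength_curve_def open_interval_def)
  have \<phi>_onto: "\<phi> ` J = I" and "smooth_on J \<phi>"
    using \<phi> by (auto simp: diffeo_def bij_betw_def)
  have \<phi>_I: "\<phi> \<sigma> \<in> I" if "\<sigma> \<in> J" for \<sigma>
    using \<phi>_onto that by blast
  have d\<phi>: "(\<phi> has_vector_derivative vderiv \<phi> \<sigma>) (at \<sigma>)" if "\<sigma> \<in> J" for \<sigma>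
    using smooth_on_imp_has_vderiv[OF J(1) \<open>smooth_on J \<phi>\<close> that] .
  have circles: "great_circle (\<alpha> (\<phi> \<sigma>)) (N\<^sub>\<alpha> (\<phi> \<sigma>)) = great_circle (\<beta> \<sigma>) (B\<^sub>\<beta> \<sigma>)" if "\<sigma> \<in> J" for \<sigma>
    using circles'[OF that] frenet_normal_unique[OF \<alpha> frame frame' \<phi>_I[OF that]] by simp
  note on_\<alpha> = frenet_orthonormal[OF \<alpha> frame \<phi>_I]
  note on_\<beta> = frenet_orthonormal[OF \<beta> frame_\<beta>]
  have plane: "\<beta> \<sigma> = (\<beta> \<sigma> \<bullet> \<alpha> (\<phi> \<sigma>)) *\<^sub>R \<alpha> (\<phi> \<sigma>) + (\<beta> \<sigma> \<bullet> N\<^sub>\<alpha> (\<phi> \<sigma>)) *\<^sub>R N\<^sub>\<alpha> (\<phi> \<sigma>)"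
    "B\<^sub>\<beta> \<sigma> = (B\<^sub>\<beta> \<sigma> \<bullet> \<alpha> (\<phi> \<sigma>)) *\<^sub>R \<alpha> (\<phi> \<sigma>) + (B\<^sub>\<beta> \<sigma> \<bullet> N\<^sub>\<alpha> (\<phi> \<sigma>)) *\<^sub>R N\<^sub>\<alpha> (\<phi> \<sigma>)"
    if "\<sigma> \<in> J" for \<sigma>
    using great_circle_eqD[OF circles[OF that]] on_\<alpha>[OF that] by blast+
  \<comment> \<open>Exchanging the roles of the two circles: \<open>\<alpha>\<close> and \<open>N\<^sub>\<alpha>\<close> lie in the plane of \<open>\<beta>\<close> and \<open>B\<^sub>\<beta>\<close>.\<close>
  have perp: "z \<bullet> \<alpha> (\<phi> \<sigma>) = 0" "z \<bullet> N\<^sub>\<alpha> (\<phi> \<sigma>) = 0"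
    if "\<sigma> \<in> J" "z \<bullet> \<beta> \<sigma> = 0" "z \<bullet> B\<^sub>\<beta> \<sigma> = 0" for \<sigma> z
  proof -
    note r = great_circle_eqD[OF circles[OF that(1), symmetric]]
    show "z \<bullet> \<alpha> (\<phi> \<sigma>) = 0"
      by (subst r(1)) (use on_\<beta>[OF that(1)] that in \<open>simp_all add: inner_simps\<close>)
    show "z \<bullet> N\<^sub>\<alpha> (\<phi> \<sigma>) = 0"
      by (subst r(2)) (use on_\<beta>[OF that(1)] that in \<open>simp_all add: inner_simps\<close>)
  qed
  obtain c d where
    \<beta>_cd: "\<And>\<sigma>. \<sigma> \<in> J \<Longrightarrow> \<beta> \<sigma> = c *\<^sub>R \<alpha> (\<phi> \<sigma>) + d *\<^sub>R N\<^sub>\<alpha> (\<phi> \<sigma>)"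
    and T\<beta>: "\<And>\<sigma>. \<sigma> \<in> J \<Longrightarrow> T\<^sub>\<beta> \<sigma> = vderiv \<phi> \<sigma> *\<^sub>R
      ((c - d * \<kappa>\<^sub>\<alpha> (\<phi> \<sigma>)) *\<^sub>R T\<^sub>\<alpha> (\<phi> \<sigma>) + (d * \<tau>\<^sub>\<alpha> (\<phi> \<sigma>)) *\<^sub>R B\<^sub>\<alpha> (\<phi> \<sigma>))"
    using rigid_in_normal_plane[OF \<alpha> frame J(2) eq_refl[OF \<phi>_onto] d\<phi>
        frenet_equations(1)[OF \<beta> frame_\<beta>] plane(1) perp] on_\<beta> by blast
  have "(- \<tau>\<^sub>\<beta> \<sigma> *\<^sub>R N\<^sub>\<beta> \<sigma>) \<bullet> \<beta> \<sigma> = 0" "(- \<tau>\<^sub>\<beta> \<sigma> *\<^sub>R N\<^sub>\<beta> \<sigma>) \<bullet> B\<^sub>\<beta> \<sigma> = 0" if "\<sigma> \<in> J" for \<sigma>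
    using on_\<beta>[OF that] by simp_all
  then obtain e f where
    B_ef: "\<And>\<sigma>. \<sigma> \<in> J \<Longrightarrow> B\<^sub>\<beta> \<sigma> = e *\<^sub>R \<alpha> (\<phi> \<sigma>) + f *\<^sub>R N\<^sub>\<alpha> (\<phi> \<sigma>)"
    and dB: "\<And>\<sigma>. \<sigma> \<in> J \<Longrightarrow> - \<tau>\<^sub>\<beta> \<sigma> *\<^sub>R N\<^sub>\<beta> \<sigma> = vderiv \<phi> \<sigma> *\<^sub>R
      ((e - f * \<kappa>\<^sub>\<alpha> (\<phi> \<sigma>)) *\<^sub>R T\<^sub>\<alpha> (\<phi> \<sigma>) + (f * \<tau>\<^sub>\<alpha> (\<phi> \<sigma>)) *\<^sub>R B\<^sub>\<alpha> (\<phi> \<sigma>))"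
    using rigid_in_normal_plane[OF \<alpha> frame J(2) eq_refl[OF \<phi>_onto] d\<phi>
        frenet_equations(4)[OF \<beta> frame_\<beta>] plane(2) perp] by blast
  obtain \<sigma>\<^sub>0 where \<sigma>\<^sub>0: "\<sigma>\<^sub>0 \<in> J"
    using J(3) by blast
  have "c * c + d * d = 1" "e * e + f * f = 1" "c * e + d * f = 0"
    using on_\<beta>(1,4,7)[OF \<sigma>\<^sub>0] on_\<alpha>[OF \<sigma>\<^sub>0]
    unfolding \<beta>_cd[OF \<sigma>\<^sub>0] B_ef[OF \<sigma>\<^sub>0] by (simp_all add: inner_simps algebra_simps)
  \<comment> \<open>The determinant of the change of basis from \<open>\<alpha>, N\<^sub>\<alpha>\<close> to \<open>\<beta>, B\<^sub>\<beta>\<close>, so a sign.\<close>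
  define \<epsilon> where "\<epsilon> = c * f - d * e"
  have ef: "e = - d * \<epsilon>" "f = c * \<epsilon>"
    using \<open>c * c + d * d = 1\<close> \<open>c * e + d * f = 0\<close> unfolding \<epsilon>_def by algebra+
  have "\<epsilon> \<noteq> 0"
    using \<open>e * e + f * f = 1\<close> ef by auto
  \<comment> \<open>The component of \<open>T\<^sub>\<beta>\<close> along \<open>T\<^sub>\<alpha>\<close>, up to the speed of \<open>\<phi>\<close>.\<close>
  define P where "P s = c - d * \<kappa>\<^sub>\<alpha> s" for s
  have \<kappa>_pos: "\<kappa>\<^sub>\<alpha> s > 0" if "s \<in> I" for s
    using frame that by (simp add: frenet_frame_def)
  have mannheim: "(d + c * \<kappa>\<^sub>\<alpha> s) * P s = c * d * (\<tau>\<^sub>\<alpha> s)\<^sup>2" and P_nz: "P s \<noteq> 0" if "s \<in> I" for s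
  proof -
    obtain \<sigma> where \<sigma>: "\<sigma> \<in> J" "s = \<phi> \<sigma>"
      using \<phi>_onto \<open>s \<in> I\<close> by blast
    have nz: "T\<^sub>\<beta> \<sigma> \<noteq> 0"
      using on_\<beta>(2)[OF \<sigma>(1)] by auto
    then have "vderiv \<phi> \<sigma> \<noteq> 0"
      using T\<beta>[OF \<sigma>(1)] by auto
    have "T\<^sub>\<beta> \<sigma> \<bullet> (- \<tau>\<^sub>\<beta> \<sigma> *\<^sub>R N\<^sub>\<beta> \<sigma>) =
        (vderiv \<phi> \<sigma>)\<^sup>2 * (P s * (e - f * \<kappa>\<^sub>\<alpha> s) + d * \<tau>\<^sub>\<alpha> s * (f * \<tau>\<^sub>\<alpha> s))"
      unfolding T\<beta>[OF \<sigma>(1)] dB[OF \<sigma>(1)] using on_\<alpha>[OF \<sigma>(1)]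
      by (simp add: inner_add_left inner_add_right \<sigma>(2) P_def power2_eq_square algebra_simps)
    moreover have "T\<^sub>\<beta> \<sigma> \<bullet> (- \<tau>\<^sub>\<beta> \<sigma> *\<^sub>R N\<^sub>\<beta> \<sigma>) = 0"
      using on_\<beta>[OF \<sigma>(1)] by simp
    ultimately have "(vderiv \<phi> \<sigma>)\<^sup>2 *
        (P s * (e - f * \<kappa>\<^sub>\<alpha> s) + d * \<tau>\<^sub>\<alpha> s * (f * \<tau>\<^sub>\<alpha> s)) = 0"
      by simp
    then have "P s * (e - f * \<kappa>\<^sub>\<alpha> s) + d * \<tau>\<^sub>\<alpha> s * (f * \<tau>\<^sub>\<alpha> s) = 0"
      using \<open>vderiv \<phi> \<sigma> \<noteq> 0\<close> by simp
    then have "\<epsilon> * (c * d * (\<tau>\<^sub>\<alpha> s)\<^sup>2 - (d + c * \<kappa>\<^sub>\<alpha> s) * P s) = 0"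
      unfolding ef by (simp add: algebra_simps power2_eq_square)
    then show *: "(d + c * \<kappa>\<^sub>\<alpha> s) * P s = c * d * (\<tau>\<^sub>\<alpha> s)\<^sup>2"
      using \<open>\<epsilon> \<noteq> 0\<close> by simp
    show "P s \<noteq> 0"
    proof
      assume "P s = 0"
      then have "d * \<tau>\<^sub>\<alpha> s = 0"
        using * \<kappa>_pos[OF \<open>s \<in> I\<close>] by (auto simp: P_def)
      then show False
        using nz T\<beta>[OF \<sigma>(1)] \<open>P s = 0\<close> by (simp add: P_def \<sigma>(2))
    qed
  qed
  then have "c \<noteq> 0" "d \<noteq> 0"
    using mannheim[OF \<phi>_I[OF \<sigma>\<^sub>0]] \<kappa>_pos[OF \<phi>_I[OF \<sigma>\<^sub>0]] \<open>c * c + d * d = 1\<close> by (auto simp: P_def)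
  define \<mu> where "\<mu> s = c * \<tau>\<^sub>\<alpha> s / P s" for s
  have "smooth_on I \<mu>"
  proof -
    have "ndiff_on n I \<mu>" for n
    proof -
      note mult = ndiff_on_bilinear[OF I bounded_bilinear_mult]
      have "ndiff_on n I \<kappa>\<^sub>\<alpha>" "ndiff_on n I \<tau>\<^sub>\<alpha>"
        using frenet_curvatures_smooth[OF \<alpha> frame] by (auto simp: smooth_on_iff_ndiff_on)
      then have "ndiff_on n I (\<lambda>s. c + (- d) * \<kappa>\<^sub>\<alpha> s)"
        by (intro ndiff_on_add I mult ndiff_on_const)
      then have "ndiff_on n I P"
        by (simp add: P_def[abs_def])
      then have "ndiff_on n I (\<lambda>s. c * \<tau>\<^sub>\<alpha> s * inverse (P s))"
        using \<open>ndiff_on n I \<tau>\<^sub>\<alpha>\<close> P_nz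
        by (intro mult ndiff_on_const ndiff_on_inverse I)
      then show ?thesis
        by (simp add: \<mu>_def[abs_def] divide_inverse)
    qed
    then show ?thesis
      by (simp add: smooth_on_iff_ndiff_on)
  qed
  moreover have "\<not> \<mu> constant_on I"
  proof
    assume "\<mu> constant_on I"
    then obtain m where m: "\<And>s. s \<in> I \<Longrightarrow> \<mu> s = m"
      by (auto simp: constant_on_def)
    \<comment> \<open>The ratio of the components \<open>d * \<tau>\<^sub>\<alpha>\<close> and \<open>P\<close> of \<open>T\<^sub>\<beta>\<close>.\<close>
    define k where "k = d * m / c"
    have "T\<^sub>\<beta> \<sigma> = (vderiv \<phi> \<sigma> * P (\<phi> \<sigma>)) *\<^sub>R (T\<^sub>\<alpha> (\<phi> \<sigma>) + k *\<^sub>R B\<^sub>\<alpha> (\<phi> \<sigma>))" if "\<sigma> \<in> J" for \<sigma>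
    proof -
      have "d * \<tau>\<^sub>\<alpha> (\<phi> \<sigma>) = P (\<phi> \<sigma>) * k"
        using m[OF \<phi>_I[OF that]] P_nz[OF \<phi>_I[OF that]] \<open>c \<noteq> 0\<close>
        by (auto simp: \<mu>_def k_def field_simps)
      then show ?thesis
        using T\<beta>[OF that] by (simp add: P_def[symmetric] algebra_simps)
    qed
    moreover have "N\<^sub>\<beta> \<sigma>\<^sub>0 \<bullet> \<alpha> (\<phi> \<sigma>\<^sub>0) = 0" "N\<^sub>\<beta> \<sigma>\<^sub>0 \<bullet> N\<^sub>\<alpha> (\<phi> \<sigma>\<^sub>0) = 0"
      using perp[OF \<sigma>\<^sub>0] on_\<beta>[OF \<sigma>\<^sub>0] by blast+
    ultimately show False
      by (intro rectifying_direction_not_fixed[OF \<alpha> frame \<beta> frame_\<beta> eq_refl[OF \<phi>_onto] d\<phi> \<sigma>\<^sub>0,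
            where r = "\<lambda>\<sigma>. vderiv \<phi> \<sigma> * P (\<phi> \<sigma>)" and k = k])
  qed
  moreover have "1 = (- c / d) * \<kappa>\<^sub>\<alpha> s + \<mu> s * \<tau>\<^sub>\<alpha> s" if "s \<in> I" for s
  proof -
    have "\<mu> s * \<tau>\<^sub>\<alpha> s = c * d * (\<tau>\<^sub>\<alpha> s)\<^sup>2 / (d * P s)"
      using \<open>d \<noteq> 0\<close> by (simp add: \<mu>_def power2_eq_square)
    also have "\<dots> = (d + c * \<kappa>\<^sub>\<alpha> s) / d"
      using P_nz[OF that] by (simp flip: mannheim[OF that])
    also have "\<dots> = 1 - (- c / d) * \<kappa>\<^sub>\<alpha> s"
      using \<open>d \<noteq> 0\<close> by (simp add: field_simps)
    finally show ?thesis
      by simp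
  qed
  ultimately show ?thesis
    by blast
qed

end
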